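(* Let $k\ge1$ be an integer and let $P=(E,r)$ be a $k$-polymatroid. (i) If $k$ is odd, then $$T_k(P;x+1,y+1)=\sum_{A\subseteq E}T_k(P|_A;0,y+1)\,T_k(P/A;x+1,0).$$ (ii) If $k$ is even, then both $$T_k(P;x+1,y+1)=\sum_{A\subseteq E}(-1)^{r(P|_A)}\,\chi\big((P|_A)^*;-y\big)\,T_k(P/A;x+1,0)$$ and $$T_k(P;x+1,y+1)=\sum_{A\subseteq E}(-1)^{r(P/A)}\,T_k(P|_A;0,y+1)\,\chi(P/A;-x).$$
   Context: A polymatroid is a pair $P=(E,r)$ with $E$ a finite set and $r:2^E\to\mathbb{Z}$ such that $r(\emptyset)=0$, $r(A)\le r(B)$ whenever $A\subseteq B$, and $r(A)+r(B)\ge r(A\cup B)+r(A\cap B)$ for all $A,B\subseteq E$. It is a $k$-polymatroid if $r(\{e\})\le k$ for all $e\in E$. For a polymatroid $Q$, $r(Q)$ denotes the rank of its whole groundset. Restriction: $P|_A=(A,r|_{2^A})$. Contraction: $P/A=(E\setminus A,r_{P/A})$ with $r_{P/A}(X)=r(X\cup A)-r(A)$. The $k$-dual of a $k$-polymatroid $P=(E,r)$ is $P^*=(E,r^* )$ with $r^*(A)=k|A|+r(E\setminus A)-r(E)$. $k$-polymatroid Tutte polynomial: $T_k(P;x,y)=\sum_{A\subseteq E}(x-1)^{r(E)-r(A)}(y-1)^{k|A|-r(A)}$. Characteristic polynomial: $\chi(P;x)=\sum_{A\subseteq E}(-1)^{|A|}x^{r(E)-r(A)}$. *)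

theory Defs
  imports Main
begin

text \<open>
  A pair (E, r) of a groundset and a rank function. Only the values of r on subsets of E are
  meaningful: every definition below evaluates r on such subsets only.
\<close>

type_synonym 'e ranked_set = "'e set \<times> ('e set \<Rightarrow> int)"

abbreviation ground :: "'e ranked_set \<Rightarrow> 'e set" where
  "ground P \<equiv> fst P"

abbreviation rk :: "'e ranked_set \<Rightarrow> 'e set \<Rightarrow> int" where
  "rk P \<equiv> snd P"

definition polymatroid :: "'e ranked_set \<Rightarrow> bool" where
  "polymatroid P \<longleftrightarrow>
     finite (ground P) \<and>
     rk P {} = 0 \<and>
     (\<forall>A B. A \<subseteq> B \<and> B \<subseteq> ground P \<longrightarrow> rk P A \<le> rk P B) \<and>
     (\<forall>A B. A \<subseteq> ground P \<and> B \<subseteq> ground P \<longrightarrow>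
        rk P A + rk P B \<ge> rk P (A \<union> B) + rk P (A \<inter> B))"

definition k_polymatroid :: "nat \<Rightarrow> 'e ranked_set \<Rightarrow> bool" where
  "k_polymatroid k P \<longleftrightarrow> polymatroid P \<and> (\<forall>e \<in> ground P. rk P {e} \<le> int k)"

definition total_rank :: "'e ranked_set \<Rightarrow> int" where
  "total_rank P = rk P (ground P)"

definition restriction :: "'e ranked_set \<Rightarrow> 'e set \<Rightarrow> 'e ranked_set" where
  "restriction P A = (A, rk P)"

definition contraction :: "'e ranked_set \<Rightarrow> 'e set \<Rightarrow> 'e ranked_set" where
  "contraction P A = (ground P - A, \<lambda>X. rk P (X \<union> A) - rk P A)"

definition k_dual :: "nat \<Rightarrow> 'e ranked_set \<Rightarrow> 'e ranked_set" where
  "k_dual k P =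
     (ground P, \<lambda>A. int k * int (card A) + rk P (ground P - A) - rk P (ground P))"

text \<open>
  The two polynomials have integer coefficients and are given by their values in an arbitrary
  commutative ring; the polynomials themselves are the values at indeterminates.
  The exponents are non-negative for k-polymatroids (for the characteristic polynomial, for all
  polymatroids), so the conversion to nat loses nothing there.
\<close>

definition tutte :: "nat \<Rightarrow> 'e ranked_set \<Rightarrow> 'a::comm_ring_1 \<Rightarrow> 'a \<Rightarrow> 'a" where
  "tutte k P x y =
     (\<Sum>A \<in> Pow (ground P).
        (x - 1) ^ nat (rk P (ground P) - rk P A) *
        (y - 1) ^ nat (int k * int (card A) - rk P A))"

definition char_poly :: "'e ranked_set \<Rightarrow> 'a::comm_ring_1 \<Rightarrow> 'a" where
  "char_poly P x =
     (\<Sum>A \<in> Pow (ground P). (- 1) ^ card A * x ^ nat (rk P (ground P) - rk P A))"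

end

theory Submission
  imports Defs Complex_Main
begin

text \<open>
  Expanding all three right-hand sides gives a sum over chains \<open>B \<subseteq> A \<subseteq> D \<subseteq> E\<close> whose summand is
  \<open>(-1)\<^bsup>|A|\<^esup>\<close> times a term that depends on \<open>B\<close> and \<open>D\<close> only. The alternating sum over the
  interval \<open>[B, D]\<close> of the Boolean lattice vanishes unless \<open>B = D\<close>, and the diagonal terms add up
  to the Tutte polynomial.
\<close>

section \<open>Alternating sums over intervals and chains of sets\<close>

lemma alternating_sum_interval:
  assumes "finite D" and "B \<subseteq> D"
  shows "(\<Sum>A | B \<subseteq> A \<and> A \<subseteq> D. (- 1) ^ card A :: 'a::comm_ring_1) =
           (if B = D then (- 1) ^ card D else 0)"
proof (cases "B = D")
  case True
  then have "{A. B \<subseteq> A \<and> A \<subseteq> D} = {D}" by auto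
  with True show ?thesis by simp
next
  case False
  with assms have "B \<subset> D" by auto
  have "finite {A. B \<subseteq> A \<and> A \<subseteq> D}"
    using assms by (auto intro: finite_subset[of _ "Pow D"])
  \<comment> \<open>As \<open>B\<close> is properly contained in \<open>D\<close>, toggling an
    element of \<open>D - B\<close> pairs the even sets of the interval with the odd ones, so the
    signs cancel.\<close>
  moreover have "card {A \<in> {A. B \<subseteq> A \<and> A \<subseteq> D}. even (card A)} =
      card {A \<in> {A. B \<subseteq> A \<and> A \<subseteq> D}. odd (card A)}"
    using card_subsupersets_even_odd[OF \<open>finite D\<close> \<open>B \<subset> D\<close>] by (simp add: conj_ac)
  ultimately show ?thesis
    using False by (simp add: sum_alternating_cancels)
qed

text \<open>\<open>u A B\<close> stands for a summand over the restriction to \<open>A\<close>, and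
  \<open>v A D\<close> for a summand over the contraction by \<open>A\<close>, indexed by
  \<open>D = C \<union> A\<close>. By \<open>uv\<close> their product sees \<open>A\<close> only
  through \<open>(- 1) ^ card A\<close>. With the sum over \<open>A\<close> moved innermost, only
  the pairs \<open>B = D\<close> survive.\<close>

lemma convolution_collapse:
  fixes u v w :: "'e set \<Rightarrow> 'e set \<Rightarrow> 'a::comm_ring_1"
  assumes "finite E"
    and uv: "\<And>A B D. B \<subseteq> A \<Longrightarrow> A \<subseteq> D \<Longrightarrow> D \<subseteq> E \<Longrightarrow>
               u A B * v A D = (- 1) ^ card A * w B D"
  shows "(\<Sum>A\<in>Pow E. (\<Sum>B\<in>Pow A. u A B) * (\<Sum>C\<in>Pow (E - A). v A (C \<union> A))) =
           (\<Sum>B\<in>Pow E. (- 1) ^ card B * w B B)"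
proof -
  \<comment> \<open>The ranges depend on \<open>A\<close>. Moving the chain condition into the
    summand makes all ranges \<open>Pow E\<close>, so that the sums can be interchanged.\<close>
  have "(\<Sum>B\<in>Pow A. u A B) * (\<Sum>C\<in>Pow (E - A). v A (C \<union> A)) =
      (\<Sum>B\<in>Pow E. \<Sum>D\<in>Pow E. if B \<subseteq> A \<and> A \<subseteq> D then (- 1) ^ card A * w B D else 0)"
    if "A \<subseteq> E" for A
  proof -
    have "(\<Sum>C\<in>Pow (E - A). v A (C \<union> A)) = (\<Sum>D | A \<subseteq> D \<and> D \<subseteq> E. v A D)"
      by (rule sum.reindex_bij_witness[of _ "\<lambda>D. D - A" "\<lambda>C. C \<union> A"]) (use that in auto)
    also have "(\<Sum>B\<in>Pow A. u A B) * \<dots> =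
        (\<Sum>B\<in>Pow A. \<Sum>D | A \<subseteq> D \<and> D \<subseteq> E. (- 1) ^ card A * w B D)"
      by (auto simp: sum_product uv intro!: sum.cong)
    also have "\<dots> = (\<Sum>B\<in>Pow A. \<Sum>D\<in>Pow E.
        if B \<subseteq> A \<and> A \<subseteq> D then (- 1) ^ card A * w B D else 0)"
      using \<open>finite E\<close> by (intro sum.cong refl sum.mono_neutral_cong_left) auto
    also have "\<dots> = (\<Sum>B\<in>Pow E. \<Sum>D\<in>Pow E.
        if B \<subseteq> A \<and> A \<subseteq> D then (- 1) ^ card A * w B D else 0)"
      using \<open>finite E\<close> that by (intro sum.mono_neutral_left) auto
    finally show ?thesis .
  qed
  then have "(\<Sum>A\<in>Pow E. (\<Sum>B\<in>Pow A. u A B) * (\<Sum>C\<in>Pow (E - A). v A (C \<union> A))) =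
      (\<Sum>A\<in>Pow E. \<Sum>B\<in>Pow E. \<Sum>D\<in>Pow E.
        if B \<subseteq> A \<and> A \<subseteq> D then (- 1) ^ card A * w B D else 0)"
    by (intro sum.cong) auto
  also have "\<dots> = (\<Sum>B\<in>Pow E. \<Sum>A\<in>Pow E. \<Sum>D\<in>Pow E.
        if B \<subseteq> A \<and> A \<subseteq> D then (- 1) ^ card A * w B D else 0)"
    by (rule sum.swap)
  also have "\<dots> = (\<Sum>B\<in>Pow E. \<Sum>D\<in>Pow E. \<Sum>A\<in>Pow E.
        if B \<subseteq> A \<and> A \<subseteq> D then (- 1) ^ card A * w B D else 0)"
    by (intro sum.cong refl sum.swap)
  also have "\<dots> = (\<Sum>B\<in>Pow E. \<Sum>D\<in>Pow E. if B = D then (- 1) ^ card D * w B D else 0)"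
  proof (intro sum.cong refl)
    fix B D assume "B \<in> Pow E" "D \<in> Pow E"
    then have "(\<Sum>A\<in>Pow E. if B \<subseteq> A \<and> A \<subseteq> D then (- 1) ^ card A * w B D else 0) =
        (\<Sum>A | B \<subseteq> A \<and> A \<subseteq> D. (- 1) ^ card A * w B D)"
      using \<open>finite E\<close> by (intro sum.mono_neutral_cong_right) auto
    also have "\<dots> = (\<Sum>A | B \<subseteq> A \<and> A \<subseteq> D. (- 1) ^ card A) * w B D"
      by (simp add: sum_distrib_right)
    also have "\<dots> = (if B = D then (- 1) ^ card D * w B D else 0)"
    proof (cases "B \<subseteq> D")
      case True
      with \<open>D \<in> Pow E\<close> \<open>finite E\<close> show ?thesis
        by (simp add: alternating_sum_interval finite_subset)
    next
      \<comment> \<open>The interval is empty, and the right-hand side is 0 too.\<close>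
      case False
      then have empty: "{A. B \<subseteq> A \<and> A \<subseteq> D} = {}" and "B \<noteq> D" by auto
      then show ?thesis unfolding empty by simp
    qed
    finally show "(\<Sum>A\<in>Pow E. if B \<subseteq> A \<and> A \<subseteq> D then (- 1) ^ card A * w B D else 0) =
        (if B = D then (- 1) ^ card D * w B D else 0)" .
  qed
  also have "\<dots> = (\<Sum>B\<in>Pow E. (- 1) ^ card B * w B B)"
    using \<open>finite E\<close> by (intro sum.cong refl) simp
  finally show ?thesis .
qed

section \<open>Rank bounds that make the exponents non-negative\<close>

lemma polymatroid_rank_mono:
  "polymatroid P \<Longrightarrow> A \<subseteq> B \<Longrightarrow> B \<subseteq> ground P \<Longrightarrow> rk P A \<le> rk P B"
  by (simp add: polymatroid_def)

lemma polymatroid_rank_nonneg: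
  assumes "polymatroid P" and "A \<subseteq> ground P"
  shows "0 \<le> rk P A"
  using polymatroid_rank_mono[of P "{}" A] assms by (simp add: polymatroid_def)

text \<open>The elements of \<open>D - A\<close> are added one at a time; by submodularity each
  raises the rank by at most the rank of its singleton, hence by at most \<open>k\<close>. This is
  the non-negativity of the exponents \<open>k|C| - r(C)\<close> of a contraction, without which
  \<open>nat\<close> would truncate and lose their parity.\<close>

lemma k_polymatroid_rank_diff_le:
  assumes P: "k_polymatroid k P" and "A \<subseteq> D" and "D \<subseteq> ground P"
  shows "rk P D - rk P A \<le> int k * (int (card D) - int (card A))"
proof -
  have poly: "polymatroid P" and fin: "finite (ground P)"
    using P by (simp_all add: k_polymatroid_def polymatroid_def)
  have "rk P (A \<union> C) - rk P A \<le> int k * int (card C)"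
    if "finite C" "C \<subseteq> ground P - A" for C
    using that
  proof (induction C)
    case empty
    then show ?case by simp
  next
    case (insert e C)
    \<comment> \<open>Disjointness makes the intersection term of submodularity equal to
      \<open>rk P {} = 0\<close>.\<close>
    have "(A \<union> C) \<inter> {e} = {}" using insert.hyps insert.prems by auto
    moreover have "A \<union> C \<subseteq> ground P" "{e} \<subseteq> ground P"
      using insert.prems assms by auto
    ultimately have "rk P (A \<union> insert e C) \<le> rk P (A \<union> C) + rk P {e}"
      using poly unfolding polymatroid_def
      by (metis Un_empty_right Un_insert_right add.right_neutral)
    moreover have "rk P {e} \<le> int k"
      using P insert.prems by (simp add: k_polymatroid_def)
    ultimately show ?case
      using insert by (simp add: algebra_simps)
  qed
  from this[of "D - A"] have "rk P D - rk P A \<le> int k * int (card (D - A))"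
    using assms fin by (auto simp: Un_absorb1 intro: finite_subset)
  moreover have "int (card (D - A)) = int (card D) - int (card A)"
    using assms fin by (metis card_Diff_subset card_mono finite_subset of_nat_diff)
  ultimately show ?thesis by simp
qed

lemma k_polymatroid_rank_le:
  assumes "k_polymatroid k P" and "A \<subseteq> ground P"
  shows "rk P A \<le> int k * int (card A)"
  using k_polymatroid_rank_diff_le[of k P "{}" A] assms
  by (simp add: k_polymatroid_def polymatroid_def)

section \<open>The polynomials of contractions and duals in terms of the rank function of
  \<open>P\<close>\<close>

text \<open>Everything is written through \<open>C \<union> A\<close>, the upper end of a chain, to
  fit the shape \<open>v A (C \<union> A)\<close> of \<open>convolution_collapse\<close>. In the
  first exponent \<open>rk P A\<close> cancels.\<close>

lemma tutte_contraction:
  assumes "finite (ground P)" and "A \<subseteq> ground P"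
  shows "tutte k (contraction P A) x y =
    (\<Sum>C\<in>Pow (ground P - A). (x - 1) ^ nat (rk P (ground P) - rk P (C \<union> A)) *
       (y - 1) ^ nat (int k * (int (card (C \<union> A)) - int (card A)) - (rk P (C \<union> A) - rk P A)))"
proof -
  have "int (card (C \<union> A)) = int (card C) + int (card A)" if "C \<subseteq> ground P - A" for C
  proof -
    have "finite C" "finite A" "C \<inter> A = {}"
      using that assms by (auto intro: finite_subset)
    then show ?thesis by (simp add: card_Un_disjoint)
  qed
  with assms show ?thesis
    unfolding tutte_def contraction_def
    by (auto simp: Un_absorb2 intro!: sum.cong)
qed

text \<open>The sign is again expressed through \<open>C \<union> A\<close>: since \<open>C\<close>
  and \<open>A\<close> are disjoint, \<open>card C\<close> has the parity of
  \<open>card (C \<union> A) + card A\<close>, and a sum of naturals avoids truncated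
  subtraction.\<close>

lemma char_poly_contraction:
  assumes "finite (ground P)" and "A \<subseteq> ground P"
  shows "char_poly (contraction P A) x =
    (\<Sum>C\<in>Pow (ground P - A). (- 1) ^ (card (C \<union> A) + card A) *
       x ^ nat (rk P (ground P) - rk P (C \<union> A)))"
proof -
  have "(- 1) ^ (card (C \<union> A) + card A) = (- 1 :: 'b) ^ card C" if "C \<subseteq> ground P - A" for C
  proof -
    have "finite C" "finite A" "C \<inter> A = {}"
      using that assms by (auto intro: finite_subset)
    then show ?thesis by (simp add: card_Un_disjoint minus_one_power_iff)
  qed
  with assms show ?thesis
    unfolding char_poly_def contraction_def
    by (auto simp: Un_absorb2 intro!: sum.cong)
qed

text \<open>The sum is reindexed by complements relative to the ground set.\<close>

lemma char_poly_k_dual: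
  assumes "finite (ground P)" and "rk P {} = 0"
  shows "char_poly (k_dual k P) x =
    (\<Sum>B\<in>Pow (ground P). (- 1) ^ (card (ground P) + card B) *
       x ^ nat (int k * int (card B) - rk P B))"
proof -
  define E where "E = ground P"
  have [simp]: "finite E" using assms by (simp add: E_def)
  have card_compl: "card B + card (E - B) = card E" if "B \<subseteq> E" for B
    using that by (metis \<open>finite E\<close> card_Diff_subset card_mono finite_subset le_add_diff_inverse)
  \<comment> \<open>In the difference of the dual ranks of \<open>E\<close> and \<open>A\<close> the
    term \<open>rk P E\<close> cancels, and \<open>rk P {} = 0\<close>. What remains is
    \<open>k|B| - r(B)\<close> for the complement \<open>B = E - A\<close>.\<close>
  have "char_poly (k_dual k P) x = (\<Sum>A\<in>Pow E. (- 1) ^ card A *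
      x ^ nat (int k * int (card E) - (int k * int (card A) + rk P (E - A))))"
    using assms(2) unfolding char_poly_def k_dual_def
    by (simp add: E_def algebra_simps)
  also have "\<dots> = (\<Sum>B\<in>Pow E. (- 1) ^ (card E + card B) *
      x ^ nat (int k * int (card B) - rk P B))"
  proof (rule sum.reindex_bij_witness[of _ "\<lambda>B. E - B" "\<lambda>A. E - A"])
    fix A assume "A \<in> Pow E"
    then have "card E = card A + card (E - A)"
      using card_compl by simp
    then show "(- 1) ^ (card E + card (E - A)) * x ^ nat (int k * int (card (E - A)) - rk P (E - A)) =
        (- 1) ^ card A * x ^ nat (int k * int (card E) - (int k * int (card A) + rk P (E - A)))"
      by (simp add: algebra_simps minus_one_power_iff)
  qed auto
  finally show ?thesis by (simp add: E_def)
qed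

theorem theorem3p13:
  fixes k :: nat and P :: "'e ranked_set" and x y :: "'a::comm_ring_1"
  assumes "k \<ge> 1" and "k_polymatroid k P"
  shows "(odd k \<longrightarrow>
            tutte k P (x + 1) (y + 1) =
              (\<Sum>A \<in> Pow (ground P).
                 tutte k (restriction P A) 0 (y + 1) * tutte k (contraction P A) (x + 1) 0)) \<and>
         (even k \<longrightarrow>
            tutte k P (x + 1) (y + 1) =
              (\<Sum>A \<in> Pow (ground P).
                 (- 1) ^ nat (total_rank (restriction P A)) *
                 char_poly (k_dual k (restriction P A)) (- y) *
                 tutte k (contraction P A) (x + 1) 0) \<and>
            tutte k P (x + 1) (y + 1) =
              (\<Sum>A \<in> Pow (ground P).
                 (- 1) ^ nat (total_rank (contraction P A)) *
                 tutte k (restriction P A) 0 (y + 1) *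
                 char_poly (contraction P A) (- x)))"
proof -
  define E where "E = ground P"
  define r where "r = rk P"
  \<comment> \<open>For a chain \<open>B \<subseteq> A \<subseteq> D\<close>, \<open>X D\<close> and
    \<open>Y B\<close> are the parts of the summand that remain once all signs are split
    off.\<close>
  define X where "X D = x ^ nat (r E - r D)" for D
  define Y where "Y B = y ^ nat (int k * int (card B) - r B)" for B
  have poly: "polymatroid P" and fin: "finite E" and fin_sub: "\<And>A. A \<subseteq> E \<Longrightarrow> finite A"
    and r0: "r {} = 0"
    using assms(2) by (auto simp: k_polymatroid_def polymatroid_def E_def r_def
        intro: finite_subset)
  have mono: "r A \<le> r B" if "A \<subseteq> B" "B \<subseteq> E" for A B
    using polymatroid_rank_mono[OF poly] that by (simp add: E_def r_def)
  have nonneg: "0 \<le> r A" if "A \<subseteq> E" for A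
    using polymatroid_rank_nonneg[OF poly] that by (simp add: E_def r_def)
  have diff_le: "r D - r A \<le> int k * (int (card D) - int (card A))"
    if "A \<subseteq> D" "D \<subseteq> E" for A D
    using k_polymatroid_rank_diff_le[OF assms(2)] that by (simp add: E_def r_def)
  have le: "r A \<le> int k * int (card A)" if "A \<subseteq> E" for A
    using k_polymatroid_rank_le[OF assms(2)] that by (simp add: E_def r_def)

  have T: "tutte k P (x + 1) (y + 1) = (\<Sum>B\<in>Pow E. X B * Y B)"
    by (simp add: tutte_def E_def r_def X_def Y_def)
  \<comment> \<open>The argument 0 turns the base into -1, so one of the two powers becomes a sign;
    the same happens in \<open>T_contr\<close>.\<close>
  have T_restr: "tutte k (restriction P A) 0 (y + 1) =
      (\<Sum>B\<in>Pow A. (- 1) ^ nat (r A - r B) * Y B)" for A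
    by (simp add: tutte_def restriction_def r_def Y_def)
  have T_contr: "tutte k (contraction P A) (x + 1) 0 =
      (\<Sum>C\<in>Pow (E - A). X (C \<union> A) *
         (- 1) ^ nat (int k * (int (card (C \<union> A)) - int (card A)) - (r (C \<union> A) - r A)))"
    if "A \<subseteq> E" for A
    using tutte_contraction[of P A k "x + 1" 0] fin that by (simp add: E_def r_def X_def)
  have dual_restr: "(- 1) ^ nat (total_rank (restriction P A)) *
        char_poly (k_dual k (restriction P A)) (- y) =
      (\<Sum>B\<in>Pow A. (- 1) ^ nat (r A) * ((- 1) ^ (card A + card B) *
         (- y) ^ nat (int k * int (card B) - r B)))"
    if "A \<subseteq> E" for A
    using char_poly_k_dual[of "restriction P A" k "- y"] fin_sub[OF that] r0
    by (simp add: restriction_def total_rank_def r_def sum_distrib_left)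
  have chi_contr: "(- 1) ^ nat (total_rank (contraction P A)) *
        char_poly (contraction P A) (- x) =
      (\<Sum>C\<in>Pow (E - A). (- 1) ^ nat (r E - r A) * ((- 1) ^ (card (C \<union> A) + card A) *
         (- x) ^ nat (r E - r (C \<union> A))))"
    if "A \<subseteq> E" for A
    using char_poly_contraction[of P A "- x"] fin that
    by (simp add: contraction_def total_rank_def r_def E_def sum_distrib_left Un_absorb2)

  \<comment> \<open>The total sign exponent is \<open>2|B| + 2r(B)\<close>, so all signs
    vanish.\<close>
  have diagonal: "(\<Sum>B\<in>Pow E. (- 1) ^ card B *
      ((- 1) ^ nat (int (card B) + r B + r B) * X B * Y B)) = tutte k P (x + 1) (y + 1)"
    unfolding T by (intro sum.cong refl)
      (auto simp: minus_one_power_iff even_nat_iff nonneg)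

  \<comment> \<open>The two candidates for \<open>w\<close> differ only in using \<open>|D|\<close>
    or \<open>|B|\<close> in the sign. They agree for \<open>B = D\<close>, so
    \<open>diagonal\<close> serves both.\<close>
  let ?wD = "\<lambda>B D. (- 1) ^ nat (int (card D) + r B + r D) * X D * Y B"
  let ?wB = "\<lambda>B D. (- 1) ^ nat (int (card B) + r B + r D) * X D * Y B"

  have "tutte k P (x + 1) (y + 1) = (\<Sum>A \<in> Pow (ground P).
      tutte k (restriction P A) 0 (y + 1) * tutte k (contraction P A) (x + 1) 0)" if "odd k"
  proof -
    have "(\<Sum>A\<in>Pow E. (\<Sum>B\<in>Pow A. (- 1) ^ nat (r A - r B) * Y B) *
        (\<Sum>C\<in>Pow (E - A). X (C \<union> A) *
         (- 1) ^ nat (int k * (int (card (C \<union> A)) - int (card A)) - (r (C \<union> A) - r A)))) =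
        (\<Sum>B\<in>Pow E. (- 1) ^ card B * ?wD B B)"
    proof (rule convolution_collapse[OF fin, where w = ?wD and v = "\<lambda>A D. X D *
          (- 1) ^ nat (int k * (int (card D) - int (card A)) - (r D - r A))"])
      fix A B D assume s: "B \<subseteq> A" "A \<subseteq> D" "D \<subseteq> E"
      then have "r B \<le> r A" "0 \<le> r B" "0 \<le> r D"
        "r D - r A \<le> int k * (int (card D) - int (card A))"
        by (auto intro!: mono nonneg diff_le)
      \<comment> \<open>Modulo 2, \<open>r A\<close> cancels and, as \<open>k\<close> is odd,
        \<open>k(|D| - |A|)\<close> becomes \<open>|D| + |A|\<close>: this is the source of the sign
        \<open>(- 1) ^ card A\<close>.\<close>
      then show "(- 1) ^ nat (r A - r B) * Y B * (X D *
          (- 1) ^ nat (int k * (int (card D) - int (card A)) - (r D - r A))) =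
          (- 1) ^ card A * ?wD B D"
        using \<open>odd k\<close> by (auto simp: minus_one_power_iff even_nat_iff mult.commute)
    qed
    also have "\<dots> = tutte k P (x + 1) (y + 1)"
      by (rule diagonal)
    finally show ?thesis
      by (simp add: T_restr T_contr flip: E_def)
  qed
  moreover have "tutte k P (x + 1) (y + 1) = (\<Sum>A \<in> Pow (ground P).
      (- 1) ^ nat (total_rank (restriction P A)) *
      char_poly (k_dual k (restriction P A)) (- y) *
      tutte k (contraction P A) (x + 1) 0)" if "even k"
  proof -
    have "(\<Sum>A\<in>Pow E. (\<Sum>B\<in>Pow A. (- 1) ^ nat (r A) * ((- 1) ^ (card A + card B) *
         (- y) ^ nat (int k * int (card B) - r B))) *
        (\<Sum>C\<in>Pow (E - A). X (C \<union> A) *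
         (- 1) ^ nat (int k * (int (card (C \<union> A)) - int (card A)) - (r (C \<union> A) - r A)))) =
        (\<Sum>B\<in>Pow E. (- 1) ^ card B * ?wB B B)"
    proof (rule convolution_collapse[OF fin, where w = ?wB and v = "\<lambda>A D. X D *
          (- 1) ^ nat (int k * (int (card D) - int (card A)) - (r D - r A))"])
      fix A B D assume s: "B \<subseteq> A" "A \<subseteq> D" "D \<subseteq> E"
      then have "0 \<le> r A" "0 \<le> r B" "0 \<le> r D" "r B \<le> int k * int (card B)"
        "r D - r A \<le> int k * (int (card D) - int (card A))"
        by (auto intro!: nonneg diff_le le)
      \<comment> \<open>For even \<open>k\<close> the multiples of \<open>k\<close> contribute no
        sign; \<open>(- 1) ^ card A\<close> now comes from the dual's characteristic polynomial. The
        prefactor \<open>(- 1) ^ nat (r A)\<close> cancels the \<open>r A\<close> of the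
        contraction.\<close>
      then show "(- 1) ^ nat (r A) * ((- 1) ^ (card A + card B) *
          (- y) ^ nat (int k * int (card B) - r B)) * (X D *
          (- 1) ^ nat (int k * (int (card D) - int (card A)) - (r D - r A))) =
          (- 1) ^ card A * ?wB B D"
        unfolding Y_def power_minus[of y]
        using \<open>even k\<close> by (auto simp: minus_one_power_iff even_nat_iff mult.commute)
    qed
    also have "\<dots> = tutte k P (x + 1) (y + 1)"
      by (rule diagonal)
    finally show ?thesis
      by (simp add: dual_restr T_contr flip: E_def)
  qed
  moreover have "tutte k P (x + 1) (y + 1) = (\<Sum>A \<in> Pow (ground P).
      (- 1) ^ nat (total_rank (contraction P A)) *
      tutte k (restriction P A) 0 (y + 1) *
      char_poly (contraction P A) (- x))"
  proof -
    have "(\<Sum>A\<in>Pow E. (\<Sum>B\<in>Pow A. (- 1) ^ nat (r A - r B) * Y B) *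
        (\<Sum>C\<in>Pow (E - A). (- 1) ^ nat (r E - r A) * ((- 1) ^ (card (C \<union> A) + card A) *
         (- x) ^ nat (r E - r (C \<union> A))))) =
        (\<Sum>B\<in>Pow E. (- 1) ^ card B * ?wD B B)"
    proof (rule convolution_collapse[OF fin, where w = ?wD and v = "\<lambda>A D. (- 1) ^ nat (r E - r A) * ((- 1) ^ (card D + card A) *
          (- x) ^ nat (r E - r D))"])
      fix A B D assume s: "B \<subseteq> A" "A \<subseteq> D" "D \<subseteq> E"
      then have "r B \<le> r A" "0 \<le> r B" "0 \<le> r D" "r A \<le> r E" "r D \<le> r E"
        by (auto intro!: nonneg mono)
      \<comment> \<open>Here \<open>(- 1) ^ card A\<close> comes from the characteristic polynomial
        of the contraction. Modulo 2, \<open>r A\<close> and \<open>r E\<close> each occur twice: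
        the prefactor supplies one copy of each, while the others come from the restriction and from
        the power of \<open>- x\<close>.\<close>
      then show "(- 1) ^ nat (r A - r B) * Y B *
          ((- 1) ^ nat (r E - r A) * ((- 1) ^ (card D + card A) * (- x) ^ nat (r E - r D))) =
          (- 1) ^ card A * ?wD B D"
        unfolding X_def power_minus[of x]
        by (auto simp: minus_one_power_iff even_nat_iff mult.commute)
    qed
    also have "\<dots> = tutte k P (x + 1) (y + 1)"
      by (rule diagonal)
    finally have "tutte k P (x + 1) (y + 1) = (\<Sum>A\<in>Pow E. tutte k (restriction P A) 0 (y + 1) *
        ((- 1) ^ nat (total_rank (contraction P A)) * char_poly (contraction P A) (- x)))"
      by (simp add: T_restr chi_contr)
    then show ?thesis
      by (simp add: E_def mult_ac)
  qed
  ultimately show ?thesis by blast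
qed

end
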